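(* Let $n\ge 1$ and let $x_1,\dots,x_n\in\mathbb{R}^n$ be unit vectors. Let $X$ be the real $n\times n$ matrix whose $j$-th row is $x_j$, and let $a_1,\dots,a_n$ denote the diagonal entries of the matrix $(XX^{\ast})^{1/2}$. Then $$\max_{\|y\|=1}\prod_{j=1}^{n}|(Xy)_j|\ \ge\ a_1\cdots a_n\cdot n^{-n/2},$$ where the maximum is over unit vectors $y\in\mathbb{R}^n$.
   Context: $\mathbb{R}^n$ carries the standard inner product $\langle\cdot,\cdot\rangle$ and Euclidean norm $\|\cdot\|$. $X^{\ast}$ is the transpose of $X$, so $XX^{\ast}=[\langle x_i,x_j\rangle]_{i,j}$ is the Gram matrix of $x_1,\dots,x_n$, and $(Xy)_j=\langle x_j,y\rangle$. $(XX^{\ast})^{1/2}$ is the positive semidefinite self-adjoint square root of $XX^{\ast}$. *)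

theory Defs
  imports "HOL-Analysis.Analysis"
begin

definition psd_matrix :: "real^'n^'n \<Rightarrow> bool" where
  "psd_matrix A \<longleftrightarrow> transpose A = A \<and> (\<forall>v. 0 \<le> v \<bullet> (A *v v))"

text \<open>
  The square root of a positive semidefinite matrix; its value is unspecified on matrices
  that are not positive semidefinite.
\<close>
definition psd_sqrt :: "real^'n^'n \<Rightarrow> real^'n^'n" where
  "psd_sqrt A = (THE S. psd_matrix S \<and> S ** S = A)"

end

theory Submission imports Defs begin

text \<open>
  Write \<open>S = X U\<close> with \<open>U\<close> orthogonal and \<open>S\<close> positive semidefinite (polar decomposition).
  Then \<open>S S = S S\<^sup>T = X X\<^sup>T\<close>, so \<open>S\<close> is the square root of the Gram matrix and its diagonal
  is \<open>a\<^sub>1, \<dots>, a\<^sub>n\<close>. Among the \<open>2\<^sup>n\<close> sign vectors choose \<open>e\<close> maximising the quadratic form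
  \<open>e \<bullet> S e\<close>. Flipping the sign of one coordinate \<open>e\<^sub>j\<close> changes the form by
  \<open>4 (S\<^sub>j\<^sub>j - e\<^sub>j (S e)\<^sub>j)\<close>, which is therefore at most zero; hence \<open>\<bar>(S e)\<^sub>j\<bar> \<ge> a\<^sub>j\<close> for every
  \<open>j\<close> at once. The vector \<open>z = U e / sqrt n\<close> is a unit vector with \<open>X z = S e / sqrt n\<close>, and
  multiplying the \<open>n\<close> coordinate bounds gives the inequality at \<open>z\<close>, hence at a maximiser, which
  exists because the unit sphere is compact.

  The polar decomposition is obtained without diagonalisation. The orthogonal
  group is compact, so some \<open>U\<close> maximises \<open>trace (X U)\<close>; comparing \<open>U\<close> with its products with one
  or two hyperplane reflections shows that \<open>X U\<close> is positive semidefinite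
  (\<open>psd_matrix_if_trace_maximal\<close>). Since \<^const>\<open>psd_sqrt\<close> is a definite description, uniqueness of
  the root is needed too; it comes from a trace identity (\<open>psd_square_root_unique\<close>).
\<close>

section \<open>Positive semidefinite matrices\<close>

text \<open>
  The first-order condition of an extremum, in a form that needs no derivatives: near \<open>t = 0\<close> the
  quadratic term is too small to dominate a nonzero linear one of either sign.
\<close>
lemma linear_le_quadratic_imp_zero:
  fixes b c :: real
  assumes "\<And>t. t * b \<le> t\<^sup>2 * c"
  shows "b = 0"
proof (rule ccontr)
  assume b: "b \<noteq> 0"
  define d where "d = \<bar>c\<bar> + 1"
  have d: "d > 0" "c < d" by (auto simp: d_def)
  \<comment> \<open>The value \<open>t = b / d\<close> turns the inequality into \<open>d \<le> c\<close>.\<close>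
  have "(b / d) * b \<le> (b / d)\<^sup>2 * c" by (rule assms)
  then have "b\<^sup>2 * d \<le> b\<^sup>2 * c"
    using d(1) by (simp add: field_simps power2_eq_square)
  moreover have "b\<^sup>2 * c < b\<^sup>2 * d"
    using b d(2) by simp
  ultimately show False by simp
qed

lemma inner_matrix_vector_mult_left:
  fixes A :: "real^'n^'m"
  shows "(A *v v) \<bullet> w = v \<bullet> (transpose A *v w)"
  by (metis dot_lmul_matrix transpose_matrix_vector transpose_transpose)

lemma psd_matrix_self_adjoint:
  assumes "psd_matrix S"
  shows "(S *v v) \<bullet> w = v \<bullet> (S *v w)"
  using assms inner_matrix_vector_mult_left[of S v w] by (simp add: psd_matrix_def)

text \<open>
  A zero \<open>v\<close> of the form \<open>x \<bullet> S x\<close> minimises it, so its directional derivatives at \<open>v\<close> vanish; the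
  derivative in direction \<open>S v\<close> is twice the squared norm of \<open>S v\<close>.
\<close>
lemma psd_matrix_null_vector:
  fixes S :: "real^'n^'n"
  assumes S: "psd_matrix S" and v: "v \<bullet> (S *v v) = 0"
  shows "S *v v = 0"
proof -
  define w where "w = S *v v"
  have "t * (- 2 * (w \<bullet> w)) \<le> t\<^sup>2 * (w \<bullet> (S *v w))" for t
  proof -
    have "0 \<le> (v + t *\<^sub>R w) \<bullet> (S *v (v + t *\<^sub>R w))"
      using S by (simp add: psd_matrix_def)
    also have "\<dots> = v \<bullet> (S *v v) + t * ((v \<bullet> (S *v w)) + w \<bullet> (S *v v)) + t\<^sup>2 * (w \<bullet> (S *v w))"
      by (simp add: algebra_simps inner_add_left inner_add_right matrix_vector_right_distrib
          matrix_vector_mult_scaleR power2_eq_square)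
    also have "v \<bullet> (S *v w) = w \<bullet> w"
      using psd_matrix_self_adjoint[OF S, of v w] by (simp add: w_def)
    finally show ?thesis
      using v by (simp add: w_def)
  qed
  then have "- 2 * (w \<bullet> w) = 0" by (rule linear_le_quadratic_imp_zero)
  then show ?thesis by (simp add: w_def)
qed

lemma psd_matrix_diagonal_nonneg: "psd_matrix S \<Longrightarrow> 0 \<le> S $ j $ j"
  unfolding psd_matrix_def
  by (metis cart_eq_inner_axis inner_commute matrix_vector_mult_basis column_def vec_lambda_beta)

lemma trace_eq_sum_inner_axis:
  fixes A :: "real^'n^'n"
  shows "trace A = (\<Sum>i\<in>UNIV. axis i 1 \<bullet> (A *v axis i 1))"
  by (simp add: trace_def inner_axis' matrix_vector_mult_basis column_def)

lemma matrix_add_rdistrib: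
  fixes A B :: "real^'n^'m"
  shows "(A + B) ** C = A ** C + B ** C"
  by (simp add: matrix_eq matrix_vector_mult_add_rdistrib flip: matrix_vector_mul_assoc)

lemma trace_zero: "trace (0 :: real^'n^'n) = 0"
  by (simp add: trace_def)

text \<open>
  Put \<open>D = S - T\<close>. From \<open>S\<^sup>2 - T\<^sup>2 = D S + T D\<close> the hypothesis gives
  \<open>trace (D S D) + trace (D T D) = 0\<close>. Both \<open>D S D\<close> and \<open>D T D\<close> are positive semidefinite, so all
  their diagonal entries vanish. Hence \<open>S\<close> and \<open>T\<close> annihilate the columns of \<open>D\<close>, so \<open>D\<^sup>2 = 0\<close>,
  and \<open>D = 0\<close> because \<open>D\<close> is symmetric.
\<close>
lemma psd_square_root_unique:
  fixes S T :: "real^'n^'n"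
  assumes S: "psd_matrix S" and T: "psd_matrix T" and eq: "S ** S = T ** T"
  shows "S = T"
proof -
  define D where "D = S - T"
  have D_apply: "D *v v = S *v v - T *v v" for v
    by (simp add: D_def matrix_vector_mult_diff_rdistrib)
  have D_sym: "(D *v v) \<bullet> w = v \<bullet> (D *v w)" for v w
    by (simp add: D_apply inner_diff_left inner_diff_right
        psd_matrix_self_adjoint[OF S] psd_matrix_self_adjoint[OF T])
  have "D ** S + T ** D = 0"
    using eq by (simp add: matrix_eq D_apply matrix_vector_mult_add_rdistrib
        matrix_vector_mult_diff_distrib flip: matrix_vector_mul_assoc)
  then have "(D ** S + T ** D) ** D = 0" by simp
  then have "trace (D ** S ** D) + trace (T ** D ** D) = 0"
    by (metis matrix_add_rdistrib trace_add trace_zero)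
  then have "trace (D ** S ** D) + trace (D ** T ** D) = 0"
    by (metis trace_mul_sym matrix_mul_assoc)
  moreover have tr: "trace (D ** A ** D) = (\<Sum>i\<in>UNIV. (D *v axis i 1) \<bullet> (A *v (D *v axis i 1)))" for A
    by (simp add: trace_eq_sum_inner_axis D_sym flip: matrix_vector_mul_assoc)
  moreover have nonneg: "0 \<le> (D *v axis i 1) \<bullet> (S *v (D *v axis i 1))"
      "0 \<le> (D *v axis i 1) \<bullet> (T *v (D *v axis i 1))" for i
    using S T by (simp_all add: psd_matrix_def)
  ultimately have "trace (D ** S ** D) = 0" "trace (D ** T ** D) = 0"
    by (simp_all add: tr sum_nonneg add_nonneg_eq_0_iff)
  then have "(D *v axis i 1) \<bullet> (S *v (D *v axis i 1)) = 0"
      "(D *v axis i 1) \<bullet> (T *v (D *v axis i 1)) = 0" for i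
    by (simp_all add: tr sum_nonneg_eq_0_iff nonneg)
  then have "D *v (D *v axis i 1) = 0" for i
    by (simp add: D_apply[of "D *v axis i 1"] psd_matrix_null_vector[OF S] psd_matrix_null_vector[OF T])
  then have "(D *v axis i 1) \<bullet> (D *v axis i 1) = 0" for i
    by (simp only: D_sym) simp
  then have "column i D = 0" for i
    by (simp add: matrix_vector_mult_basis)
  then have "D = 0"
    by (simp add: column_def vec_eq_iff)
  then show ?thesis by (simp add: D_def)
qed

lemma psd_sqrt_eqI:
  assumes "psd_matrix S" "S ** S = A"
  shows "psd_sqrt A = S"
  unfolding psd_sqrt_def using assms by (blast intro: psd_square_root_unique)

section \<open>Polar decomposition\<close>

definition hyperplane_reflection :: "real^'n \<Rightarrow> real^'n^'n" where
  "hyperplane_reflection u = matrix (\<lambda>w. w - (2 * (u \<bullet> w) / (u \<bullet> u)) *\<^sub>R u)"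

lemma hyperplane_reflection_apply:
  "hyperplane_reflection u *v w = w - (2 * (u \<bullet> w) / (u \<bullet> u)) *\<^sub>R u"
proof -
  have "linear (\<lambda>w. w - (2 * (u \<bullet> w) / (u \<bullet> u)) *\<^sub>R u)"
    by (rule linearI) (auto simp: algebra_simps inner_add_right add_divide_distrib)
  then show ?thesis by (simp add: hyperplane_reflection_def matrix_works)
qed

lemma orthogonal_hyperplane_reflection: "orthogonal_matrix (hyperplane_reflection u)"
proof -
  have "norm (hyperplane_reflection u *v w) = norm w" for w
    unfolding hyperplane_reflection_apply norm_eq_sqrt_inner
    by (cases "u = 0")
      (simp_all add: inner_diff_left inner_diff_right field_simps inner_commute)
  then have "orthogonal_transformation (\<lambda>w. hyperplane_reflection u *v w)"
    by (simp add: orthogonal_transformation)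
  then show ?thesis by (simp add: orthogonal_transformation_matrix)
qed

lemma trace_mult_hyperplane_reflection:
  fixes A :: "real^'n^'n"
  shows "trace (A ** hyperplane_reflection u) = trace A - 2 * (u \<bullet> (A *v u)) / (u \<bullet> u)"
proof -
  have "trace (A ** hyperplane_reflection u)
      = trace A - (\<Sum>i\<in>UNIV. 2 * u $ i * (A *v u) $ i / (u \<bullet> u))"
    by (simp add: trace_eq_sum_inner_axis hyperplane_reflection_apply inner_axis inner_axis'
        matrix_vector_mult_diff_distrib matrix_vector_mult_scaleR sum_subtractf
        flip: matrix_vector_mul_assoc)
  also have "(\<Sum>i\<in>UNIV. 2 * u $ i * (A *v u) $ i / (u \<bullet> u)) = 2 * (u \<bullet> (A *v u)) / (u \<bullet> u)"
    by (simp add: inner_vec_def sum_distrib_left sum_divide_distrib mult.assoc)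
  finally show ?thesis .
qed

text \<open>
  Reflections serve as competitors. A single reflection in direction \<open>v\<close> lowers the
  trace by a positive multiple of \<open>v \<bullet> M v\<close>, so maximality forces this form to be nonnegative.
  The product of the reflections in the directions \<open>e\<^sub>i\<close> and \<open>e\<^sub>i + t e\<^sub>j\<close> is a rotation of the
  \<open>(i, j)\<close>-plane, close to the identity for small \<open>t\<close>; to first order in \<open>t\<close> it changes the trace
  by a multiple of \<open>M\<^sub>j\<^sub>i - M\<^sub>i\<^sub>j\<close>, which must vanish at a maximum.
\<close>
lemma psd_matrix_if_trace_maximal:
  fixes M :: "real^'n^'n"
  assumes max: "\<And>R. orthogonal_matrix R \<Longrightarrow> trace (M ** R) \<le> trace M"
  shows "psd_matrix M"
  unfolding psd_matrix_def
proof (intro conjI allI)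
  fix v :: "real^'n"
  show "0 \<le> v \<bullet> (M *v v)"
  proof (cases "v = 0")
    case False
    have "trace M - 2 * (v \<bullet> (M *v v)) / (v \<bullet> v) \<le> trace M"
      using max[OF orthogonal_hyperplane_reflection[of v]]
      by (simp add: trace_mult_hyperplane_reflection)
    moreover have "v \<bullet> v > 0" using False by simp
    ultimately show ?thesis by (simp add: zero_le_divide_iff)
  qed simp
next
  have entry: "axis i 1 \<bullet> (M *v axis j 1) = M $ i $ j" for i j
    by (simp add: inner_axis' matrix_vector_mult_basis column_def)
  have "M $ j $ i = M $ i $ j" if "i \<noteq> j" for i j
  proof -
    have "t * (M $ j $ i - M $ i $ j) \<le> t\<^sup>2 * (M $ i $ i + M $ j $ j)" for t
    proof -
      define v :: "real^'n" where "v = axis i 1"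
      define u :: "real^'n" where "u = axis i 1 + t *\<^sub>R axis j 1"
      let ?s = "1 + t\<^sup>2"
      have s: "?s > 0" by (simp add: add_pos_nonneg)
      have uu: "u \<bullet> u = ?s"
        using that by (simp add: u_def inner_add_left inner_add_right inner_axis_axis power2_eq_square)
      have vv: "v \<bullet> v = 1" and vu: "v \<bullet> u = 1"
        using that by (simp_all add: v_def u_def inner_add_right inner_axis_axis)
      have vMv: "v \<bullet> (M *v v) = M $ i $ i"
        by (simp add: v_def entry)
      have uMv: "u \<bullet> (M *v v) = M $ i $ i + t * M $ j $ i"
        by (simp add: v_def u_def inner_add_left entry)
      have uMu: "u \<bullet> (M *v u) = M $ i $ i + t * (M $ i $ j + M $ j $ i) + t\<^sup>2 * M $ j $ j"
        by (simp add: u_def inner_add_left inner_add_right matrix_vector_right_distrib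
            matrix_vector_mult_scaleR entry algebra_simps power2_eq_square)
      have "trace (M ** hyperplane_reflection v ** hyperplane_reflection u) \<le> trace M"
        using max[OF orthogonal_matrix_mul[OF orthogonal_hyperplane_reflection[of v]
              orthogonal_hyperplane_reflection[of u]]]
        by (simp add: matrix_mul_assoc)
      then have "2 * (u \<bullet> (M *v u) - 2 * (u \<bullet> (M *v v))) / ?s + 2 * (v \<bullet> (M *v v)) \<ge> 0"
        by (simp add: trace_mult_hyperplane_reflection hyperplane_reflection_apply uu vv vu
            matrix_vector_mult_diff_distrib matrix_vector_mult_scaleR inner_diff_right
            flip: matrix_vector_mul_assoc)
      then have "0 \<le> (u \<bullet> (M *v u) - 2 * (u \<bullet> (M *v v))) + (v \<bullet> (M *v v)) * ?s"
        using s by (simp add: field_simps)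
      then show ?thesis
        by (simp add: uMu uMv vMv algebra_simps)
    qed
    then have "M $ j $ i - M $ i $ j = 0" by (rule linear_le_quadratic_imp_zero)
    then show ?thesis by simp
  qed
  then show "transpose M = M"
    by (simp add: vec_eq_iff transpose_def) metis
qed

lemma compact_orthogonal_matrices: "compact {U :: real^'n^'n. orthogonal_matrix U}"
proof -
  have "norm U \<le> real CARD('n)" if "orthogonal_matrix U" for U :: "real^'n^'n"
  proof -
    have "norm U \<le> (\<Sum>i\<in>UNIV. norm (U $ i))"
      unfolding norm_vec_def by (rule L2_set_le_sum) simp
    also have "\<dots> = real CARD('n)"
      using that by (simp add: orthogonal_matrix_orthonormal_rows row_def vec_nth_inverse)
    finally show ?thesis .
  qed
  then have "bounded {U :: real^'n^'n. orthogonal_matrix U}"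
    by (auto simp: bounded_iff)
  moreover have "closed {U :: real^'n^'n. orthogonal_matrix U}"
    unfolding orthogonal_matrix matrix_matrix_mult_def transpose_def
    by (intro closed_Collect_eq continuous_intros)
  ultimately show ?thesis by (simp add: compact_eq_bounded_closed)
qed

lemma polar_decomposition:
  fixes X :: "real^'n^'n"
  obtains U where "orthogonal_matrix U" "psd_matrix (X ** U)"
proof -
  have "continuous_on {U. orthogonal_matrix U} (\<lambda>U. trace (X ** U))"
    unfolding trace_def matrix_matrix_mult_def by (auto intro!: continuous_intros)
  then obtain U where U: "orthogonal_matrix U"
    and max: "\<And>V. orthogonal_matrix V \<Longrightarrow> trace (X ** V) \<le> trace (X ** U)"
    using continuous_attains_sup[OF compact_orthogonal_matrices] orthogonal_matrix_id
    by (metis (no_types, lifting) empty_iff mem_Collect_eq)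
  have "psd_matrix (X ** U)"
    by (rule psd_matrix_if_trace_maximal)
      (metis U max matrix_mul_assoc orthogonal_matrix_mul)
  with U show ?thesis by (rule that)
qed

lemma psd_sqrt_gram_matrix:
  fixes X :: "real^'n^'n"
  assumes U: "orthogonal_matrix U" and S: "psd_matrix (X ** U)"
  shows "psd_sqrt (X ** transpose X) = X ** U"
proof (rule psd_sqrt_eqI[OF S])
  have "(X ** U) ** (X ** U) = (X ** U) ** transpose (X ** U)"
    using S by (simp add: psd_matrix_def)
  also have "\<dots> = X ** (U ** transpose U) ** transpose X"
    by (simp add: matrix_transpose_mul matrix_mul_assoc)
  finally show "(X ** U) ** (X ** U) = X ** transpose X"
    using U by (simp add: orthogonal_matrix_def)
qed

section \<open>Sign vectors and the product inequality\<close>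

text \<open>
  The heart of the inequality: a sign vector maximising the quadratic form of \<open>S\<close> cannot be improved
  by flipping any single sign, and these \<open>n\<close> conditions are exactly the \<open>n\<close> coordinate bounds.
\<close>
lemma exists_sign_vector_dominating_diagonal:
  fixes S :: "real^'n^'n"
  assumes S: "transpose S = S"
  obtains e :: "real^'n" where "\<And>j. \<bar>e $ j\<bar> = 1" "\<And>j. S $ j $ j \<le> e $ j * (S *v e) $ j"
proof -
  define E :: "(real^'n) set" where "E = {e. \<forall>j. e $ j \<in> {-1, 1}}"
  have "finite (vec_lambda ` (UNIV \<rightarrow>\<^sub>E {-1, 1 :: real}) :: (real^'n) set)"
    by (intro finite_imageI finite_PiE) auto
  moreover have "E \<subseteq> vec_lambda ` (UNIV \<rightarrow>\<^sub>E {-1, 1 :: real})"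
    by (auto simp: E_def image_iff PiE_UNIV_domain intro!: bexI[of _ "vec_nth _"])
  ultimately have fin: "finite E" by (rule finite_subset[rotated])
  have "(\<chi> i. 1) \<in> E" by (simp add: E_def)
  then have ne: "E \<noteq> {}" by blast
  let ?q = "\<lambda>f. f \<bullet> (S *v f)"
  have "Max (?q ` E) \<in> ?q ` E"
    using fin ne by (intro Max_in) auto
  then obtain e where e: "e \<in> E" and Max_eq: "Max (?q ` E) = ?q e"
    by (rule imageE)
  have max: "?q f \<le> ?q e" if "f \<in> E" for f
    unfolding Max_eq[symmetric] using fin that by (intro Max_ge) auto
  have sq: "e $ j * e $ j = 1" for j
    using e by (auto simp: E_def dest!: spec[of _ j])
  have "S $ j $ j \<le> e $ j * (S *v e) $ j" for j
  proof -
    \<comment> \<open>Adding \<open>-2 e\<^sub>j\<close> to the coordinate \<open>e\<^sub>j\<close> flips its sign.\<close>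
    define c where "c = - 2 * e $ j"
    define a :: "real^'n" where "a = axis j 1"
    have "e + c *\<^sub>R a \<in> E"
      using e by (auto simp: E_def c_def a_def axis_def)
    then have "(e + c *\<^sub>R a) \<bullet> (S *v (e + c *\<^sub>R a)) \<le> e \<bullet> (S *v e)"
      by (rule max)
    moreover have "e \<bullet> (S *v a) = a \<bullet> (S *v e)"
      by (metis S inner_commute inner_matrix_vector_mult_left)
    ultimately have "2 * c * (a \<bullet> (S *v e)) + c * c * (a \<bullet> (S *v a)) \<le> 0"
      by (simp add: inner_add_left inner_add_right matrix_vector_right_distrib
          matrix_vector_mult_scaleR algebra_simps)
    moreover have "a \<bullet> (S *v e) = (S *v e) $ j" "a \<bullet> (S *v a) = S $ j $ j"
      by (simp_all add: a_def inner_axis' matrix_vector_mult_basis column_def)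
    moreover have "c * c = 4"
      using sq[of j] by (simp add: c_def)
    ultimately have "2 * c * (S *v e) $ j + 4 * S $ j $ j \<le> 0" by simp
    then show ?thesis by (simp add: c_def)
  qed
  moreover have "\<bar>e $ j\<bar> = 1" for j
    using e by (auto simp: E_def dest!: spec[of _ j])
  ultimately show ?thesis by (rule that[rotated])
qed

lemma norm_sign_vector:
  fixes e :: "real^'n"
  assumes "\<And>j. \<bar>e $ j\<bar> = 1"
  shows "norm e = sqrt (real CARD('n))"
  using assms by (simp add: norm_vec_def L2_set_def abs_square_eq_1[symmetric])

theorem theorem2p5:
  fixes x :: "'n::finite \<Rightarrow> real^'n" and X :: "real^'n^'n" and a :: "'n \<Rightarrow> real"
  assumes unit: "\<And>j. norm (x j) = 1"
    and X: "X = (\<chi> j. x j)"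
    and a: "\<And>j. a j = psd_sqrt (X ** transpose X) $ j $ j"
  shows "\<exists>y. norm y = 1 \<and>
           (\<forall>z. norm z = 1 \<longrightarrow> (\<Prod>j\<in>UNIV. \<bar>(X *v z) $ j\<bar>) \<le> (\<Prod>j\<in>UNIV. \<bar>(X *v y) $ j\<bar>)) \<and>
           (\<Prod>j\<in>UNIV. \<bar>(X *v y) $ j\<bar>)
             \<ge> (\<Prod>j\<in>UNIV. a j) * real CARD('n) powr (- real CARD('n) / 2)"
proof -
  let ?n = "real CARD('n)" and ?P = "\<lambda>z. \<Prod>j\<in>UNIV. \<bar>(X *v z) $ j\<bar>"
  obtain U where U: "orthogonal_matrix U" and S: "psd_matrix (X ** U)"
    by (rule polar_decomposition)
  have a_eq: "a j = (X ** U) $ j $ j" for j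
    by (simp add: a psd_sqrt_gram_matrix[OF U S])
  have a_nonneg: "0 \<le> a j" for j
    by (simp add: a_eq psd_matrix_diagonal_nonneg[OF S])
  obtain e :: "real^'n" where e: "\<And>j. \<bar>e $ j\<bar> = 1"
    and dom: "\<And>j. a j \<le> e $ j * ((X ** U) *v e) $ j"
    using exists_sign_vector_dominating_diagonal[of "X ** U"] S
    unfolding psd_matrix_def a_eq by blast
  define z where "z = (1 / sqrt ?n) *\<^sub>R (U *v e)"
  have "orthogonal_transformation (\<lambda>v. U *v v)"
    using U by (simp add: orthogonal_transformation_matrix)
  then have "norm (U *v e) = sqrt ?n"
    by (simp add: orthogonal_transformation norm_sign_vector[OF e])
  then have z: "norm z = 1"
    by (simp add: z_def)
  have "a j / sqrt ?n \<le> \<bar>(X *v z) $ j\<bar>" for j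
  proof -
    have "a j \<le> \<bar>e $ j * ((X ** U) *v e) $ j\<bar>"
      using dom[of j] by linarith
    also have "\<dots> = \<bar>((X ** U) *v e) $ j\<bar>"
      by (simp add: abs_mult e)
    finally have "a j / sqrt ?n \<le> \<bar>((X ** U) *v e) $ j\<bar> / sqrt ?n"
      by (simp add: divide_right_mono)
    also have "\<dots> = \<bar>(X *v z) $ j\<bar>"
      by (simp add: z_def matrix_vector_mult_scaleR abs_mult matrix_vector_mul_assoc)
    finally show ?thesis .
  qed
  then have "(\<Prod>j\<in>UNIV. a j / sqrt ?n) \<le> ?P z"
    by (intro prod_mono) (simp add: a_nonneg)
  moreover have "(\<Prod>j\<in>UNIV. a j / sqrt ?n) = (\<Prod>j\<in>UNIV. a j) * ?n powr (- ?n / 2)"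
  proof -
    have "sqrt ?n ^ CARD('n) = ?n powr (?n / 2)"
      by (simp add: powr_half_sqrt[symmetric] powr_powr flip: powr_realpow)
    moreover have "?n powr (- ?n / 2) = inverse (?n powr (?n / 2))"
      by (simp flip: powr_minus)
    moreover have "(\<Prod>j\<in>UNIV. a j / sqrt ?n) = (\<Prod>j\<in>UNIV. a j) * inverse (sqrt ?n ^ CARD('n))"
      by (simp only: prod_dividef prod_constant) (simp only: divide_inverse)
    ultimately show ?thesis by simp
  qed
  ultimately have bound: "(\<Prod>j\<in>UNIV. a j) * ?n powr (- ?n / 2) \<le> ?P z"
    by simp
  have "continuous_on (sphere 0 1) ?P"
    unfolding matrix_vector_mult_def by (auto intro!: continuous_intros)
  moreover have "z \<in> sphere 0 1" using z by simp
  ultimately obtain y where y: "norm y = 1" "\<And>w. norm w = 1 \<Longrightarrow> ?P w \<le> ?P y"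
    using continuous_attains_sup[of "sphere 0 1" ?P] by auto
  then show ?thesis
    using bound z by (meson order_trans)
qed

end
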